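(* Let $(\mathfrak{S},T)$ be an oriented Hall triple system, let $S=\mathfrak{S}\cup\{e\}$ be its associated Steiner loop, and let $L$ be the associated oriented Hall loop of exponent $4$, i.e. $L=S\times\{1,-1\}$ with multiplication $(x,\xi)\cdot(y,\eta)=(xy,\,f(x,y)\,\xi\eta)$, where $f(e,x)=f(x,e)=1$ for all $x\in S$, $f(x,x)=-1$ for all $x\in S\setminus\{e\}$, and for distinct $x,y\in\mathfrak{S}$, $f(x,y)$ is the orientation function of $(\mathfrak{S},T)$. Then $L$ satisfies the Moufang's theorem: for all $\mathrm{x},\mathrm{y},\mathrm{z}\in L$ with $\mathrm{x}(\mathrm{y}\mathrm{z})=(\mathrm{x}\mathrm{y})\mathrm{z}$, the subloop of $L$ generated by $\mathrm{x},\mathrm{y},\mathrm{z}$ is a group.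
   Context: A Steiner triple system (STS) $\mathfrak{S}$ is a set of points together with a family of 3-element subsets (blocks) such that any two distinct points lie in exactly one block. A Hall triple system (HTS) is an STS in which any three non-collinear points (points not lying in one block) generate a subsystem isomorphic to the affine plane over $GF(3)$. The Steiner loop $S=\mathfrak{S}\cup\{e\}$ of an STS has multiplication: for distinct $x,y\in\mathfrak{S}$, $xy$ is the third point of the block containing $x,y$; $xx=e$; $ex=xe=x$. An oriented STS $(\mathfrak{S},T)$ is an STS in which each block is given a cyclic order; its orientation function is defined for distinct $x,y\in\mathfrak{S}$ by $f(x,y)=1$ if $(x,y,xy)$ is in the given cyclic order of its block and $f(x,y)=-1$ otherwise. The group $Z_2$ is written multiplicatively as $\{1,-1\}$. An oriented Hall loop is the oriented Steiner loop (extension of $Z_2$ by the Steiner loop with factor system $f$ as described) associated with an oriented HTS; it has exponent $4$ when $f(x,x)=-1$ for all $x\neq e$, and exponent $2$ when $f(x,x)=1$ for all $x\neq e$. *)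

theory Defs
  imports "HOL-Algebra.Group" "HOL-Library.Numeral_Type" "HOL-Library.Product_Plus"
begin

subsection \<open>Steiner and Hall triple systems\<close>

locale steiner_triple_system =
  fixes P :: "'a set" and B :: "'a set set"
  assumes block_subset: "b \<in> B \<Longrightarrow> b \<subseteq> P"
    and card_block: "b \<in> B \<Longrightarrow> card b = 3"
    and unique_block: "\<lbrakk>x \<in> P; y \<in> P; x \<noteq> y\<rbrakk> \<Longrightarrow> \<exists>!b. b \<in> B \<and> x \<in> b \<and> y \<in> b"

definition collinear_in :: "'a set set \<Rightarrow> 'a set \<Rightarrow> bool" where
  "collinear_in B X \<longleftrightarrow> (\<exists>b\<in>B. X \<subseteq> b)"

definition subsystem :: "'a set \<Rightarrow> 'a set set \<Rightarrow> 'a set \<Rightarrow> bool" where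
  "subsystem P B Q \<longleftrightarrow>
     Q \<subseteq> P \<and> (\<forall>x\<in>Q. \<forall>y\<in>Q. x \<noteq> y \<longrightarrow> (\<forall>b\<in>B. x \<in> b \<and> y \<in> b \<longrightarrow> b \<subseteq> Q))"

definition subsystem_blocks :: "'a set set \<Rightarrow> 'a set \<Rightarrow> 'a set set" where
  "subsystem_blocks B Q = {b \<in> B. b \<subseteq> Q}"

definition generated_subsystem :: "'a set \<Rightarrow> 'a set set \<Rightarrow> 'a set \<Rightarrow> 'a set" where
  "generated_subsystem P B X = \<Inter>{Q. subsystem P B Q \<and> X \<subseteq> Q}"

definition sts_isomorphic ::
  "'a set \<Rightarrow> 'a set set \<Rightarrow> 'b set \<Rightarrow> 'b set set \<Rightarrow> bool" where
  "sts_isomorphic P B P' B' \<longleftrightarrow> (\<exists>\<phi>. bij_betw \<phi> P P' \<and> (`) \<phi> ` B = B')"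

text \<open>The numeral type \<^typ>\<open>3\<close> carries arithmetic modulo 3 and so serves as \<open>GF(3)\<close>.
  The blocks of the affine plane are its lines.\<close>

definition affine_plane_lines :: "(3 \<times> 3) set set" where
  "affine_plane_lines = {range (\<lambda>t. p + (t * u, t * v)) | p u v. (u, v) \<noteq> (0, 0)}"

locale hall_triple_system = steiner_triple_system +
  assumes plane: "\<lbrakk>x \<in> P; y \<in> P; z \<in> P; distinct [x, y, z]; \<not> collinear_in B {x, y, z}\<rbrakk> \<Longrightarrow>
     (let Q = generated_subsystem P B {x, y, z}
      in sts_isomorphic Q (subsystem_blocks B Q) UNIV affine_plane_lines)"

text \<open>An orientation is given by the set \<open>T\<close> of all triples \<open>(x, y, z)\<close> that are in the cyclic
  order chosen on the block \<open>{x, y, z}\<close>; each block thus contributes the three rotations of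
  one of its two cyclic orders.\<close>

locale oriented_hall_triple_system = hall_triple_system +
  fixes T :: "('a \<times> 'a \<times> 'a) set"
  assumes orient_block: "(x, y, z) \<in> T \<Longrightarrow> {x, y, z} \<in> B"
    and orient_rotate: "(x, y, z) \<in> T \<Longrightarrow> (y, z, x) \<in> T"
    and orient_choice: "{x, y, z} \<in> B \<Longrightarrow> (x, y, z) \<in> T \<longleftrightarrow> (x, z, y) \<notin> T"


subsection \<open>Loops\<close>

definition is_loop :: "('a, 'm) monoid_scheme \<Rightarrow> bool" where
  "is_loop G \<longleftrightarrow>
     \<one>\<^bsub>G\<^esub> \<in> carrier G \<and>
     (\<forall>x\<in>carrier G. \<forall>y\<in>carrier G. x \<otimes>\<^bsub>G\<^esub> y \<in> carrier G) \<and>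
     (\<forall>x\<in>carrier G. \<one>\<^bsub>G\<^esub> \<otimes>\<^bsub>G\<^esub> x = x \<and> x \<otimes>\<^bsub>G\<^esub> \<one>\<^bsub>G\<^esub> = x) \<and>
     (\<forall>a\<in>carrier G. \<forall>b\<in>carrier G. \<exists>!x. x \<in> carrier G \<and> a \<otimes>\<^bsub>G\<^esub> x = b) \<and>
     (\<forall>a\<in>carrier G. \<forall>b\<in>carrier G. \<exists>!y. y \<in> carrier G \<and> y \<otimes>\<^bsub>G\<^esub> a = b)"

definition subloop :: "'a set \<Rightarrow> ('a, 'm) monoid_scheme \<Rightarrow> bool" where
  "subloop H G \<longleftrightarrow> H \<subseteq> carrier G \<and> is_loop (G\<lparr>carrier := H\<rparr>)"

definition generated_subloop :: "('a, 'm) monoid_scheme \<Rightarrow> 'a set \<Rightarrow> 'a set" where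
  "generated_subloop G X = \<Inter>{H. subloop H G \<and> X \<subseteq> H}"

definition satisfies_moufang_theorem :: "('a, 'm) monoid_scheme \<Rightarrow> bool" where
  "satisfies_moufang_theorem G \<longleftrightarrow>
     (\<forall>x\<in>carrier G. \<forall>y\<in>carrier G. \<forall>z\<in>carrier G.
        x \<otimes>\<^bsub>G\<^esub> (y \<otimes>\<^bsub>G\<^esub> z) = (x \<otimes>\<^bsub>G\<^esub> y) \<otimes>\<^bsub>G\<^esub> z \<longrightarrow>
        group (G\<lparr>carrier := generated_subloop G {x, y, z}\<rparr>))"


subsection \<open>Steiner loops and oriented Hall loops\<close>

definition third_point :: "'a set set \<Rightarrow> 'a \<Rightarrow> 'a \<Rightarrow> 'a" where
  "third_point B x y = (THE z. {x, y, z} \<in> B)"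

text \<open>The adjoined identity \<open>e\<close> is \<^const>\<open>None\<close>, and a point \<open>x\<close> becomes \<^term>\<open>Some x\<close>.\<close>

fun steiner_mult :: "'a set set \<Rightarrow> 'a option \<Rightarrow> 'a option \<Rightarrow> 'a option" where
  "steiner_mult B None y = y"
| "steiner_mult B x None = x"
| "steiner_mult B (Some x) (Some y) = (if x = y then None else Some (third_point B x y))"

definition steiner_loop :: "'a set \<Rightarrow> 'a set set \<Rightarrow> 'a option monoid" where
  "steiner_loop P B =
     \<lparr>carrier = insert None (Some ` P), monoid.mult = steiner_mult B, one = None\<rparr>"

definition orientation_function ::
  "'a set set \<Rightarrow> ('a \<times> 'a \<times> 'a) set \<Rightarrow> 'a \<Rightarrow> 'a \<Rightarrow> int" where
  "orientation_function B T x y = (if (x, y, third_point B x y) \<in> T then 1 else -1)"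

text \<open>The value \<open>-1\<close> on the diagonal is what gives the loop exponent 4.\<close>

fun factor_system4 ::
  "'a set set \<Rightarrow> ('a \<times> 'a \<times> 'a) set \<Rightarrow> 'a option \<Rightarrow> 'a option \<Rightarrow> int" where
  "factor_system4 B T None y = 1"
| "factor_system4 B T x None = 1"
| "factor_system4 B T (Some x) (Some y) = (if x = y then -1 else orientation_function B T x y)"

definition oriented_hall_loop4 ::
  "'a set \<Rightarrow> 'a set set \<Rightarrow> ('a \<times> 'a \<times> 'a) set \<Rightarrow> ('a option \<times> int) monoid" where
  "oriented_hall_loop4 P B T =
     \<lparr>carrier = carrier (steiner_loop P B) \<times> {1, -1},
      monoid.mult = (\<lambda>(x, \<xi>) (y, \<eta>). (x \<otimes>\<^bsub>steiner_loop P B\<^esub> y, factor_system4 B T x y * \<xi> * \<eta>)),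
      one = (None, 1)\<rparr>"

end

theory Submission
  imports Defs "HOL-Analysis.Cartesian_Space"
begin

text \<open>In the affine plane over \<open>GF(3)\<close> the third point of the line through \<open>x\<close> and \<open>y\<close> is
  \<open>-x - y\<close>. So for non-collinear points \<open>a, b, c\<close> of a Hall triple system the products \<open>a(bc)\<close> and
  \<open>(ab)c\<close> have coordinates \<open>-a + b + c\<close> and \<open>a + b - c\<close>, which differ because \<open>a \<noteq> c\<close>. An associating
  triple of \<open>L\<close> therefore lies over a set \<open>{e, p, q, pq}\<close> of the Steiner loop. The part of \<open>L\<close> over
  such a set is associative: it is the quaternion group, or cyclic of order 2 or 4.\<close>

section \<open>Generated subloops\<close>

lemma is_loopI:
  assumes "\<one>\<^bsub>G\<^esub> \<in> carrier G"
    and "\<And>x y. \<lbrakk>x \<in> carrier G; y \<in> carrier G\<rbrakk> \<Longrightarrow> x \<otimes>\<^bsub>G\<^esub> y \<in> carrier G"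
    and "\<And>x. x \<in> carrier G \<Longrightarrow> \<one>\<^bsub>G\<^esub> \<otimes>\<^bsub>G\<^esub> x = x"
    and "\<And>x. x \<in> carrier G \<Longrightarrow> x \<otimes>\<^bsub>G\<^esub> \<one>\<^bsub>G\<^esub> = x"
    and "\<And>a b. \<lbrakk>a \<in> carrier G; b \<in> carrier G\<rbrakk> \<Longrightarrow> \<exists>!x. x \<in> carrier G \<and> a \<otimes>\<^bsub>G\<^esub> x = b"
    and "\<And>a b. \<lbrakk>a \<in> carrier G; b \<in> carrier G\<rbrakk> \<Longrightarrow> \<exists>!y. y \<in> carrier G \<and> y \<otimes>\<^bsub>G\<^esub> a = b"
  shows "is_loop G"
  using assms by (simp add: is_loop_def)

lemma subloopI:
  assumes "H \<subseteq> carrier G" "\<one>\<^bsub>G\<^esub> \<in> H"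
    and "\<And>x y. \<lbrakk>x \<in> H; y \<in> H\<rbrakk> \<Longrightarrow> x \<otimes>\<^bsub>G\<^esub> y \<in> H"
    and "\<And>x. x \<in> H \<Longrightarrow> \<one>\<^bsub>G\<^esub> \<otimes>\<^bsub>G\<^esub> x = x" "\<And>x. x \<in> H \<Longrightarrow> x \<otimes>\<^bsub>G\<^esub> \<one>\<^bsub>G\<^esub> = x"
    and "\<And>a b. \<lbrakk>a \<in> H; b \<in> H\<rbrakk> \<Longrightarrow> \<exists>!x. x \<in> H \<and> a \<otimes>\<^bsub>G\<^esub> x = b"
    and "\<And>a b. \<lbrakk>a \<in> H; b \<in> H\<rbrakk> \<Longrightarrow> \<exists>!y. y \<in> H \<and> y \<otimes>\<^bsub>G\<^esub> a = b"
  shows "subloop H G"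
  using assms by (simp add: subloop_def is_loop_def)

lemma is_loop_division:
  assumes "is_loop G" "a \<in> carrier G" "b \<in> carrier G"
  shows "\<exists>!x. x \<in> carrier G \<and> a \<otimes>\<^bsub>G\<^esub> x = b" "\<exists>!y. y \<in> carrier G \<and> y \<otimes>\<^bsub>G\<^esub> a = b"
  using assms by (simp_all add: is_loop_def)

definition associative_on :: "('a, 'm) monoid_scheme \<Rightarrow> 'a set \<Rightarrow> bool" where
  "associative_on G H \<longleftrightarrow>
     (\<forall>x\<in>H. \<forall>y\<in>H. \<forall>z\<in>H. (x \<otimes>\<^bsub>G\<^esub> y) \<otimes>\<^bsub>G\<^esub> z = x \<otimes>\<^bsub>G\<^esub> (y \<otimes>\<^bsub>G\<^esub> z))"

lemma group_if_associative_loop: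
  assumes "is_loop G" "associative_on G (carrier G)"
  shows "group G"
proof (rule groupI)
  fix x assume "x \<in> carrier G"
  moreover have "\<one>\<^bsub>G\<^esub> \<in> carrier G"
    using assms(1) by (simp add: is_loop_def)
  ultimately show "\<exists>y\<in>carrier G. y \<otimes>\<^bsub>G\<^esub> x = \<one>\<^bsub>G\<^esub>"
    using is_loop_division(2)[OF assms(1)] by blast
qed (use assms in \<open>auto simp: is_loop_def associative_on_def\<close>)

lemma ex1_in_Inter:
  assumes "A \<in> \<F>" "\<And>H. H \<in> \<F> \<Longrightarrow> H \<subseteq> A" "\<exists>!x. x \<in> A \<and> Q x"
    and "\<And>H. H \<in> \<F> \<Longrightarrow> \<exists>x\<in>H. Q x"
  shows "\<exists>!x. x \<in> \<Inter>\<F> \<and> Q x"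
proof -
  obtain x where "x \<in> A" "Q x" and unique: "\<And>y. y \<in> A \<Longrightarrow> Q y \<Longrightarrow> y = x"
    using assms(3) by blast
  have "x \<in> H" if "H \<in> \<F>" for H
    using assms(2,4)[OF that] unique by blast
  then show ?thesis
    using assms(1) \<open>Q x\<close> unique by blast
qed

lemma subloop_generated_subloop:
  assumes G: "is_loop G" and X: "X \<subseteq> carrier G"
  shows "subloop (generated_subloop G X) G"
proof -
  define \<F> where "\<F> = {H. subloop H G \<and> X \<subseteq> H}"
  have carrier: "carrier G \<in> \<F>"
    using G X by (simp add: \<F>_def subloop_def)
  have loop: "is_loop (G\<lparr>carrier := H\<rparr>)" and subset: "H \<subseteq> carrier G" if "H \<in> \<F>" for H
    using that by (simp_all add: \<F>_def subloop_def)
  have "subloop (\<Inter>\<F>) G"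
  proof (rule subloopI)
    show "\<Inter>\<F> \<subseteq> carrier G"
      using carrier by (rule Inter_lower)
    show "\<one>\<^bsub>G\<^esub> \<in> \<Inter>\<F>"
      using loop by (simp add: is_loop_def)
    show "x \<otimes>\<^bsub>G\<^esub> y \<in> \<Inter>\<F>" if "x \<in> \<Inter>\<F>" "y \<in> \<Inter>\<F>" for x y
      using that loop by (simp add: is_loop_def)
    show "\<one>\<^bsub>G\<^esub> \<otimes>\<^bsub>G\<^esub> x = x" "x \<otimes>\<^bsub>G\<^esub> \<one>\<^bsub>G\<^esub> = x" if "x \<in> \<Inter>\<F>" for x
      using that G carrier by (simp_all add: is_loop_def)
    fix a b assume ab: "a \<in> \<Inter>\<F>" "b \<in> \<Inter>\<F>"
    then have division: "\<exists>!x. x \<in> carrier G \<and> a \<otimes>\<^bsub>G\<^esub> x = b"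
      "\<exists>!y. y \<in> carrier G \<and> y \<otimes>\<^bsub>G\<^esub> a = b"
      using is_loop_division[OF G, of a b] carrier by simp_all
    have division_in: "\<exists>x\<in>H. a \<otimes>\<^bsub>G\<^esub> x = b" "\<exists>y\<in>H. y \<otimes>\<^bsub>G\<^esub> a = b" if "H \<in> \<F>" for H
      using is_loop_division[OF loop[OF that], of a b] ab that by auto
    show "\<exists>!x. x \<in> \<Inter>\<F> \<and> a \<otimes>\<^bsub>G\<^esub> x = b"
      by (rule ex1_in_Inter[OF carrier subset division(1) division_in(1)])
    show "\<exists>!y. y \<in> \<Inter>\<F> \<and> y \<otimes>\<^bsub>G\<^esub> a = b"
      by (rule ex1_in_Inter[OF carrier subset division(2) division_in(2)])
  qed
  then show ?thesis
    by (simp add: generated_subloop_def \<F>_def)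
qed

lemma group_generated_subloop:
  assumes "is_loop G" "subloop H G" "associative_on G H" "X \<subseteq> H"
  shows "group (G\<lparr>carrier := generated_subloop G X\<rparr>)"
proof (rule group_if_associative_loop)
  have "X \<subseteq> carrier G"
    using assms(2,4) by (auto simp: subloop_def)
  then show "is_loop (G\<lparr>carrier := generated_subloop G X\<rparr>)"
    using subloop_generated_subloop[OF assms(1)] by (simp add: subloop_def)
  have "generated_subloop G X \<subseteq> H"
    using assms(2,4) by (auto simp: generated_subloop_def)
  then show "associative_on (G\<lparr>carrier := generated_subloop G X\<rparr>)
      (carrier (G\<lparr>carrier := generated_subloop G X\<rparr>))"
    using assms(3) by (auto simp: associative_on_def)
qed

section \<open>Extensions of a loop by signs\<close>

definition sign_extension ::
  "('a, 'm) monoid_scheme \<Rightarrow> ('a \<Rightarrow> 'a \<Rightarrow> int) \<Rightarrow> ('a \<times> int) monoid" where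
  "sign_extension S f =
     \<lparr>carrier = carrier S \<times> {1, -1},
      monoid.mult = (\<lambda>(x, \<xi>) (y, \<eta>). (x \<otimes>\<^bsub>S\<^esub> y, f x y * \<xi> * \<eta>)),
      one = (\<one>\<^bsub>S\<^esub>, 1)\<rparr>"

lemma sign_extension_simps [simp]:
  "carrier (sign_extension S f) = carrier S \<times> {1, -1}"
  "p \<otimes>\<^bsub>sign_extension S f\<^esub> q = (fst p \<otimes>\<^bsub>S\<^esub> fst q, f (fst p) (fst q) * snd p * snd q)"
  "\<one>\<^bsub>sign_extension S f\<^esub> = (\<one>\<^bsub>S\<^esub>, 1)"
  by (simp_all add: sign_extension_def split_def)

definition normalized_sign_factor :: "('a, 'm) monoid_scheme \<Rightarrow> ('a \<Rightarrow> 'a \<Rightarrow> int) \<Rightarrow> bool" where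
  "normalized_sign_factor S f \<longleftrightarrow>
     (\<forall>x\<in>carrier S. \<forall>y\<in>carrier S. f x y \<in> {1, -1}) \<and>
     (\<forall>x\<in>carrier S. f \<one>\<^bsub>S\<^esub> x = 1 \<and> f x \<one>\<^bsub>S\<^esub> = 1)"

lemma ex1_sign_pair:
  fixes g :: "'a \<Rightarrow> int"
  assumes "\<exists>!x. x \<in> A \<and> Q x" "\<And>x. x \<in> A \<Longrightarrow> g x \<in> {1, -1}"
    and "\<alpha> \<in> {1, -1}" "\<beta> \<in> {1, -1}"
  shows "\<exists>!p. p \<in> A \<times> {1, -1} \<and> Q (fst p) \<and> g (fst p) * \<alpha> * snd p = \<beta>"
proof -
  obtain x where x: "x \<in> A" "Q x" and unique: "\<And>y. y \<in> A \<Longrightarrow> Q y \<Longrightarrow> y = x"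
    using assms(1) by blast
  show ?thesis
  proof (rule ex1I[of _ "(x, g x * \<alpha> * \<beta>)"])
    show "(x, g x * \<alpha> * \<beta>) \<in> A \<times> {1, -1} \<and> Q (fst (x, g x * \<alpha> * \<beta>)) \<and>
        g (fst (x, g x * \<alpha> * \<beta>)) * \<alpha> * snd (x, g x * \<alpha> * \<beta>) = \<beta>"
      using x assms(2)[OF x(1)] assms(3,4) by auto
    show "p = (x, g x * \<alpha> * \<beta>)"
      if "p \<in> A \<times> {1, -1} \<and> Q (fst p) \<and> g (fst p) * \<alpha> * snd p = \<beta>" for p
      using that unique[of "fst p"] assms(2)[OF x(1)] assms(3) by (cases p) auto
  qed
qed

lemma is_loop_sign_extension:
  assumes S: "is_loop S" and f: "normalized_sign_factor S f"
  shows "is_loop (sign_extension S f)"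
proof (rule is_loopI)
  let ?L = "sign_extension S f"
  have sign: "f x y \<in> {1, -1}" if "x \<in> carrier S" "y \<in> carrier S" for x y
    using f that by (simp add: normalized_sign_factor_def)
  have sign_mult: "\<xi> * \<eta> \<in> {1, -1}" if "\<xi> \<in> {1, -1}" "\<eta> \<in> {1, -1}" for \<xi> \<eta> :: int
    using that by auto
  show "x \<otimes>\<^bsub>?L\<^esub> y \<in> carrier ?L" if "x \<in> carrier ?L" "y \<in> carrier ?L" for x y
    using that S sign sign_mult by (simp add: is_loop_def mem_Times_iff del: insert_iff)
  show "\<one>\<^bsub>?L\<^esub> \<in> carrier ?L"
    using S by (simp add: is_loop_def)
  show "\<one>\<^bsub>?L\<^esub> \<otimes>\<^bsub>?L\<^esub> x = x" "x \<otimes>\<^bsub>?L\<^esub> \<one>\<^bsub>?L\<^esub> = x" if "x \<in> carrier ?L" for x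
    using that S f by (simp_all add: is_loop_def normalized_sign_factor_def mem_Times_iff prod_eq_iff)
  fix a b assume "a \<in> carrier ?L" "b \<in> carrier ?L"
  then obtain a' \<alpha> b' \<beta> where eq: "a = (a', \<alpha>)" "b = (b', \<beta>)"
    and signs: "\<alpha> \<in> {1, -1}" "\<beta> \<in> {1, -1}" and a': "a' \<in> carrier S" and b': "b' \<in> carrier S"
    by auto
  show "\<exists>!x. x \<in> carrier ?L \<and> a \<otimes>\<^bsub>?L\<^esub> x = b"
    using ex1_sign_pair[OF is_loop_division(1)[OF S a' b'] sign[OF a'] signs]
    by (simp add: eq prod_eq_iff)
  show "\<exists>!y. y \<in> carrier ?L \<and> y \<otimes>\<^bsub>?L\<^esub> a = b"
    using ex1_sign_pair[OF is_loop_division(2)[OF S a' b'] sign[OF _ a'] signs]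
    by (simp add: eq prod_eq_iff mult_ac)
qed

lemma subloop_sign_extension:
  assumes "subloop H S" "normalized_sign_factor S f"
  shows "subloop (H \<times> {1, -1}) (sign_extension S f)"
proof -
  have "normalized_sign_factor (S\<lparr>carrier := H\<rparr>) f"
    using assms by (auto simp: subloop_def normalized_sign_factor_def subset_iff)
  then have "is_loop (sign_extension (S\<lparr>carrier := H\<rparr>) f)"
    using assms(1) by (intro is_loop_sign_extension) (auto simp: subloop_def)
  moreover have "sign_extension (S\<lparr>carrier := H\<rparr>) f =
      (sign_extension S f)\<lparr>carrier := H \<times> {1, -1}\<rparr>"
    by (simp add: sign_extension_def)
  ultimately show ?thesis
    using assms(1) by (auto simp: subloop_def)
qed

definition cocycle_on ::
  "('a, 'm) monoid_scheme \<Rightarrow> ('a \<Rightarrow> 'a \<Rightarrow> int) \<Rightarrow> 'a set \<Rightarrow> bool" where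
  "cocycle_on S f H \<longleftrightarrow>
     (\<forall>x\<in>H. \<forall>y\<in>H. \<forall>z\<in>H. f x y * f (x \<otimes>\<^bsub>S\<^esub> y) z = f y z * f x (y \<otimes>\<^bsub>S\<^esub> z))"

lemma associative_on_sign_extension:
  assumes "associative_on S H" "cocycle_on S f H"
  shows "associative_on (sign_extension S f) (H \<times> \<Xi>)"
proof -
  have "(x, \<xi>) \<otimes>\<^bsub>sign_extension S f\<^esub> (y, \<eta>) \<otimes>\<^bsub>sign_extension S f\<^esub> (z, \<zeta>) =
      (x, \<xi>) \<otimes>\<^bsub>sign_extension S f\<^esub> ((y, \<eta>) \<otimes>\<^bsub>sign_extension S f\<^esub> (z, \<zeta>))"
    if "x \<in> H" "y \<in> H" "z \<in> H" for x y z \<xi> \<eta> \<zeta>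
  proof -
    have "f (x \<otimes>\<^bsub>S\<^esub> y) z * (f x y * \<xi> * \<eta>) * \<zeta> = f x y * f (x \<otimes>\<^bsub>S\<^esub> y) z * (\<xi> * \<eta> * \<zeta>)"
      by (simp only: mult_ac)
    also have "\<dots> = f y z * f x (y \<otimes>\<^bsub>S\<^esub> z) * (\<xi> * \<eta> * \<zeta>)"
      using assms(2) that by (simp add: cocycle_on_def)
    also have "\<dots> = f x (y \<otimes>\<^bsub>S\<^esub> z) * \<xi> * (f y z * \<eta> * \<zeta>)"
      by (simp only: mult_ac)
    finally show ?thesis
      using assms(1) that by (simp add: associative_on_def)
  qed
  then show ?thesis
    by (auto simp: associative_on_def)
qed

lemma satisfies_moufang_theorem_sign_extension:
  assumes S: "is_loop S" and f: "normalized_sign_factor S f"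
    and cocycle_subloop: "\<And>x y z. \<lbrakk>x \<in> carrier S; y \<in> carrier S; z \<in> carrier S;
      x \<otimes>\<^bsub>S\<^esub> (y \<otimes>\<^bsub>S\<^esub> z) = (x \<otimes>\<^bsub>S\<^esub> y) \<otimes>\<^bsub>S\<^esub> z\<rbrakk> \<Longrightarrow>
      \<exists>H. subloop H S \<and> {x, y, z} \<subseteq> H \<and> associative_on S H \<and> cocycle_on S f H"
  shows "satisfies_moufang_theorem (sign_extension S f)"
  unfolding satisfies_moufang_theorem_def
proof (intro ballI impI)
  let ?L = "sign_extension S f"
  fix x y z
  assume xyz: "x \<in> carrier ?L" "y \<in> carrier ?L" "z \<in> carrier ?L"
    and assoc: "x \<otimes>\<^bsub>?L\<^esub> (y \<otimes>\<^bsub>?L\<^esub> z) = (x \<otimes>\<^bsub>?L\<^esub> y) \<otimes>\<^bsub>?L\<^esub> z"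
  have "fst x \<otimes>\<^bsub>S\<^esub> (fst y \<otimes>\<^bsub>S\<^esub> fst z) = (fst x \<otimes>\<^bsub>S\<^esub> fst y) \<otimes>\<^bsub>S\<^esub> fst z"
    using arg_cong[OF assoc, of fst] by simp
  then obtain H where H: "subloop H S" "{fst x, fst y, fst z} \<subseteq> H"
    "associative_on S H" "cocycle_on S f H"
    using cocycle_subloop[of "fst x" "fst y" "fst z"] xyz by (auto simp: mem_Times_iff)
  show "group (?L\<lparr>carrier := generated_subloop ?L {x, y, z}\<rparr>)"
  proof (rule group_generated_subloop)
    show "is_loop ?L"
      using S f by (rule is_loop_sign_extension)
    show "subloop (H \<times> {1, -1}) ?L"
      using H(1) f by (rule subloop_sign_extension)
    show "associative_on ?L (H \<times> {1, -1})"
      using H(3,4) by (rule associative_on_sign_extension)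
    show "{x, y, z} \<subseteq> H \<times> {1, -1}"
      using xyz H(2) by (simp add: mem_Times_iff)
  qed
qed

section \<open>Coordinates in the affine plane over the field with three elements\<close>

lemma mod3_triple: "t + t + t = (0 :: 3)"
  using exhaust_3[of t] by auto

lemma mod3_distinct_sum:
  fixes r s t :: 3
  assumes "r \<noteq> s" "r \<noteq> t" "s \<noteq> t"
  shows "r + s + t = 0"
  using assms exhaust_3[of r] exhaust_3[of s] exhaust_3[of t] by auto

lemma affine_plane_double_eq_iff:
  fixes a c :: "3 \<times> 3"
  shows "a + a = c + c \<longleftrightarrow> a = c"
proof -
  have "p + p = - p" for p :: "3 \<times> 3"
    using mod3_triple[of "fst p"] mod3_triple[of "snd p"]
    by (cases p) (auto simp: eq_neg_iff_add_eq_0)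
  then show ?thesis by simp
qed

lemma affine_line_sum_eq_0:
  assumes line: "{x, y, z} \<in> affine_plane_lines" and "x \<noteq> y" "x \<noteq> z" "y \<noteq> z"
  shows "x + y + z = 0"
proof -
  obtain p u v where "{x, y, z} = range (\<lambda>t. p + (t * u, t * v))"
    using line unfolding affine_plane_lines_def by auto
  then have "\<forall>w\<in>{x, y, z}. \<exists>t. w = p + (t * u, t * v)"
    by auto
  then obtain r s t where
    xyz: "x = p + (r * u, r * v)" "y = p + (s * u, s * v)" "z = p + (t * u, t * v)"
    by auto
  have "r + s + t = 0"
    using assms(2-4) by (intro mod3_distinct_sum) (auto simp: xyz)
  moreover have "x + y + z = (fst p + fst p + fst p + (r + s + t) * u,
      snd p + snd p + snd p + (r + s + t) * v)"
    by (cases p) (simp add: xyz algebra_simps)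
  ultimately show ?thesis by (simp only: mod3_triple) (simp add: zero_prod_def)
qed

section \<open>Steiner loops\<close>

lemma third_point_commute: "third_point B x y = third_point B y x"
  by (simp add: third_point_def insert_commute)

lemma steiner_mult_commute: "steiner_mult B u v = steiner_mult B v u"
  by (cases u; cases v) (auto simp: third_point_commute)

lemma steiner_mult_None_right [simp]: "steiner_mult B u None = u"
  by (cases u) auto

lemma steiner_mult_self [simp]: "steiner_mult B u u = None"
  by (cases u) auto

context steiner_triple_system
begin

abbreviation S :: "'a option monoid" where "S \<equiv> steiner_loop P B"

lemma steiner_loop_simps [simp]:
  "carrier S = insert None (Some ` P)"
  "u \<otimes>\<^bsub>S\<^esub> v = steiner_mult B u v"
  "\<one>\<^bsub>S\<^esub> = None"
  by (simp_all add: steiner_loop_def)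

lemma block_distinct:
  assumes "{x, y, z} \<in> B"
  shows "x \<noteq> y" "x \<noteq> z" "y \<noteq> z"
  using card_block[OF assms] by (auto simp: card_insert_if split: if_splits)

lemma third_point_eq:
  assumes block: "{x, y, z} \<in> B"
  shows "third_point B x y = z"
  unfolding third_point_def
proof (rule the_equality)
  fix z' assume block': "{x, y, z'} \<in> B"
  have "x \<in> P" "y \<in> P"
    using block_subset[OF block] by auto
  then have "{x, y, z} = {x, y, z'}"
    using unique_block[OF _ _ block_distinct(1)[OF block]] block block' by blast
  then show "z' = z"
    using block_distinct[OF block] block_distinct[OF block'] by auto
qed (rule block)

lemma collinear_in_iff_block:
  assumes "distinct [x, y, z]"
  shows "collinear_in B {x, y, z} \<longleftrightarrow> {x, y, z} \<in> B"
proof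
  assume "collinear_in B {x, y, z}"
  then obtain b where "b \<in> B" "{x, y, z} \<subseteq> b"
    by (auto simp: collinear_in_def)
  moreover have "card {x, y, z} = card b" "finite b"
    using assms card_block[OF \<open>b \<in> B\<close>] by (simp_all add: card_ge_0_finite)
  ultimately show "{x, y, z} \<in> B"
    using card_subset_eq by metis
qed (simp add: collinear_in_def bexI[of _ "{x, y, z}"])

lemma third_point_block:
  assumes "x \<in> P" "y \<in> P" "x \<noteq> y"
  shows "{x, y, third_point B x y} \<in> B"
proof -
  obtain b where b: "b \<in> B" "x \<in> b" "y \<in> b"
    using unique_block[OF assms] by blast
  then obtain z where "b = {x, y, z}"
    using card_block[OF b(1)] \<open>x \<noteq> y\<close> by (auto simp: card_3_iff)
  then show ?thesis
    using b(1) third_point_eq by metis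
qed

lemma steiner_mult_closed:
  assumes "u \<in> carrier S" "v \<in> carrier S"
  shows "steiner_mult B u v \<in> carrier S"
proof -
  have "third_point B x y \<in> P" if "x \<in> P" "y \<in> P" "x \<noteq> y" for x y
    using block_subset[OF third_point_block[OF that]] by simp
  then show ?thesis
    using assms by (cases u; cases v) auto
qed

lemma steiner_mult_left_cancel:
  assumes "u \<in> carrier S" "v \<in> carrier S"
  shows "steiner_mult B u (steiner_mult B u v) = v"
proof -
  have "x \<noteq> third_point B x y \<and> third_point B x (third_point B x y) = y"
    if "x \<in> P" "y \<in> P" "x \<noteq> y" for x y
    using third_point_block[OF that] block_distinct third_point_eq by (metis insert_commute)
  then show ?thesis
    using assms by (cases u; cases v) auto
qed

lemma subloop_steiner_loopI:
  assumes "H \<subseteq> carrier S" "None \<in> H"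
    and closed: "\<And>u v. u \<in> H \<Longrightarrow> v \<in> H \<Longrightarrow> steiner_mult B u v \<in> H"
  shows "subloop H S"
proof -
  have division: "\<exists>!x. x \<in> H \<and> steiner_mult B a x = b" if "a \<in> H" "b \<in> H" for a b
  proof (rule ex1I[of _ "steiner_mult B a b"])
    show "steiner_mult B a b \<in> H \<and> steiner_mult B a (steiner_mult B a b) = b"
      using that assms(1) closed steiner_mult_left_cancel by blast
    show "x = steiner_mult B a b" if "x \<in> H \<and> steiner_mult B a x = b" for x
      using that \<open>a \<in> H\<close> assms(1) steiner_mult_left_cancel[of a x] by (metis subsetD)
  qed
  then have "\<exists>!y. y \<in> H \<and> steiner_mult B y a = b" if "a \<in> H" "b \<in> H" for a b
    using that by (simp only: steiner_mult_commute[of B _ a])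
  then show ?thesis
    using assms division by (intro subloopI) simp_all
qed

lemma is_loop_steiner_loop: "is_loop S"
proof -
  have "subloop (carrier S) S"
    by (rule subloop_steiner_loopI) (use steiner_mult_closed in auto)
  then show ?thesis
    by (simp add: subloop_def del: steiner_loop_simps)
qed

definition pair_span :: "'a option \<Rightarrow> 'a option \<Rightarrow> 'a option set" where
  "pair_span u v = {None, u, v, steiner_mult B u v}"

lemma pair_span_commute: "pair_span u v = pair_span v u"
  by (auto simp: pair_span_def steiner_mult_commute)

lemma subloop_pair_span:
  assumes "u \<in> carrier S" "v \<in> carrier S"
  shows "subloop (pair_span u v) S"
proof (rule subloop_steiner_loopI)
  show "pair_span u v \<subseteq> carrier S"
    using assms steiner_mult_closed by (auto simp: pair_span_def)
  have cancel: "steiner_mult B u (steiner_mult B u v) = v" "steiner_mult B v (steiner_mult B u v) = u"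
    using steiner_mult_left_cancel[OF assms] steiner_mult_left_cancel[OF assms(2,1)]
    by (simp_all add: steiner_mult_commute[of B v u])
  then have "steiner_mult B (steiner_mult B u v) u = v" "steiner_mult B (steiner_mult B u v) v = u"
    by (simp_all add: steiner_mult_commute[of B "steiner_mult B u v"])
  then show "steiner_mult B x y \<in> pair_span u v"
    if "x \<in> pair_span u v" "y \<in> pair_span u v" for x y
    using that cancel unfolding pair_span_def
    by (elim insertE emptyE; simp add: steiner_mult_commute[of B v u])
qed (simp add: pair_span_def)

lemma subsystem_third_point:
  assumes "subsystem P B Q" "x \<in> Q" "y \<in> Q" "x \<noteq> y"
  shows "third_point B x y \<in> Q"
proof -
  have "x \<in> P" "y \<in> P"
    using assms by (auto simp: subsystem_def)
  then have block: "{x, y, third_point B x y} \<in> B"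
    using assms(4) third_point_block by blast
  have "\<forall>b\<in>B. x \<in> b \<and> y \<in> b \<longrightarrow> b \<subseteq> Q"
    using assms by (simp add: subsystem_def)
  from bspec[OF this block] show ?thesis
    by simp
qed

lemma subsystem_generated_subsystem:
  assumes "X \<subseteq> P"
  shows "subsystem P B (generated_subsystem P B X)"
proof -
  have "subsystem P B P"
    using block_subset by (auto simp: subsystem_def)
  then have "generated_subsystem P B X \<subseteq> P"
    using assms by (auto simp: generated_subsystem_def)
  moreover have "b \<subseteq> generated_subsystem P B X"
    if "x \<in> generated_subsystem P B X" "y \<in> generated_subsystem P B X" "x \<noteq> y"
      "b \<in> B" "x \<in> b" "y \<in> b" for x y b
    unfolding generated_subsystem_def
  proof (rule Inter_greatest)
    fix Q assume Q: "Q \<in> {Q. subsystem P B Q \<and> X \<subseteq> Q}"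
    then have "x \<in> Q" "y \<in> Q"
      using that(1,2) by (auto simp: generated_subsystem_def)
    then show "b \<subseteq> Q"
      using Q that(3-6) by (simp add: subsystem_def)
  qed
  ultimately show ?thesis
    by (simp add: subsystem_def)
qed

end

section \<open>Associating triples in the Steiner loop of a Hall triple system\<close>

context hall_triple_system
begin

lemma plane_coordinates:
  assumes points: "a \<in> P" "b \<in> P" "c \<in> P" and distinct: "distinct [a, b, c]"
    and noncollinear: "{a, b, c} \<notin> B"
  obtains Q and \<phi> :: "'a \<Rightarrow> 3 \<times> 3" where "{a, b, c} \<subseteq> Q" "inj_on \<phi> Q"
    "\<And>x y. \<lbrakk>x \<in> Q; y \<in> Q; x \<noteq> y\<rbrakk> \<Longrightarrow> third_point B x y \<in> Q"
    "\<And>x y. \<lbrakk>x \<in> Q; y \<in> Q; x \<noteq> y\<rbrakk> \<Longrightarrow> \<phi> (third_point B x y) = - \<phi> x - \<phi> y"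
proof -
  define Q where "Q = generated_subsystem P B {a, b, c}"
  have Q: "subsystem P B Q"
    using points by (simp add: Q_def subsystem_generated_subsystem)
  have not_collinear: "\<not> collinear_in B {a, b, c}"
    using noncollinear collinear_in_iff_block[OF distinct] by simp
  obtain \<phi> where inj: "inj_on \<phi> Q" and lines: "(`) \<phi> ` subsystem_blocks B Q = affine_plane_lines"
    using plane[OF points distinct not_collinear]
    unfolding Let_def sts_isomorphic_def Q_def[symmetric] bij_betw_def by (elim exE conjE)
  have coordinates: "\<phi> (third_point B x y) = - \<phi> x - \<phi> y"
    if xy: "x \<in> Q" "y \<in> Q" "x \<noteq> y" for x y
  proof -
    define z where "z = third_point B x y"
    have "x \<in> P" "y \<in> P"
      using xy Q by (auto simp: subsystem_def)
    then have block: "{x, y, z} \<in> B"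
      using third_point_block xy(3) by (simp add: z_def)
    have z: "z \<in> Q"
      using subsystem_third_point[OF Q xy] by (simp add: z_def)
    then have "{x, y, z} \<in> subsystem_blocks B Q"
      using block xy by (simp add: subsystem_blocks_def)
    then have "\<phi> ` {x, y, z} \<in> affine_plane_lines"
      using lines by blast
    moreover have "\<phi> x \<noteq> \<phi> y" "\<phi> x \<noteq> \<phi> z" "\<phi> y \<noteq> \<phi> z"
      using block_distinct[OF block] xy z inj by (auto dest: inj_onD)
    ultimately have "\<phi> x + \<phi> y + \<phi> z = 0"
      by (intro affine_line_sum_eq_0) simp_all
    then show ?thesis
      by (simp add: z_def algebra_simps eq_neg_iff_add_eq_0)
  qed
  have "{a, b, c} \<subseteq> Q"
    by (auto simp: Q_def generated_subsystem_def)
  then show thesis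
    using that inj subsystem_third_point[OF Q] coordinates by blast
qed

lemma steiner_mult_not_assoc:
  assumes points: "a \<in> P" "b \<in> P" "c \<in> P" and distinct: "distinct [a, b, c]"
    and noncollinear: "{a, b, c} \<notin> B"
  shows "steiner_mult B (Some a) (steiner_mult B (Some b) (Some c)) \<noteq>
    steiner_mult B (steiner_mult B (Some a) (Some b)) (Some c)"
proof
  assume assoc: "steiner_mult B (Some a) (steiner_mult B (Some b) (Some c)) =
    steiner_mult B (steiner_mult B (Some a) (Some b)) (Some c)"
  obtain Q and \<phi> :: "'a \<Rightarrow> 3 \<times> 3" where Q: "{a, b, c} \<subseteq> Q" and inj: "inj_on \<phi> Q"
    and closed: "\<And>x y. \<lbrakk>x \<in> Q; y \<in> Q; x \<noteq> y\<rbrakk> \<Longrightarrow> third_point B x y \<in> Q"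
    and coordinates: "\<And>x y. \<lbrakk>x \<in> Q; y \<in> Q; x \<noteq> y\<rbrakk> \<Longrightarrow> \<phi> (third_point B x y) = - \<phi> x - \<phi> y"
    using plane_coordinates[OF assms] by blast
  have not_third: "a \<noteq> third_point B b c" "third_point B a b \<noteq> c"
    using third_point_block[of b c] third_point_block[of a b] points distinct noncollinear
    by (auto simp: insert_commute)
  have "\<phi> (third_point B a (third_point B b c)) = - \<phi> a + \<phi> b + \<phi> c"
    using Q distinct not_third by (simp add: coordinates closed)
  moreover have "\<phi> (third_point B (third_point B a b) c) = \<phi> a + \<phi> b - \<phi> c"
    using Q distinct not_third by (simp add: coordinates closed)
  ultimately have "- \<phi> a + \<phi> b + \<phi> c = \<phi> a + \<phi> b - \<phi> c"
    using assoc distinct not_third by simp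
  then have "\<phi> a + \<phi> a = \<phi> c + \<phi> c"
    by (simp add: algebra_simps)
  then have "\<phi> a = \<phi> c"
    by (simp add: affine_plane_double_eq_iff)
  then show False
    using inj Q distinct by (auto dest: inj_onD)
qed

lemma associating_triple_in_pair_span:
  assumes carrier: "u \<in> carrier S" "v \<in> carrier S" "w \<in> carrier S"
    and assoc: "steiner_mult B u (steiner_mult B v w) = steiner_mult B (steiner_mult B u v) w"
  obtains s t where "s \<in> carrier S" "t \<in> carrier S" "{u, v, w} \<subseteq> pair_span s t"
proof (cases "None \<in> {u, v, w} \<or> \<not> distinct [u, v, w]")
  case True
  then have "{u, v, w} \<subseteq> pair_span u v \<or> {u, v, w} \<subseteq> pair_span u w \<or> {u, v, w} \<subseteq> pair_span v w"
    by (auto simp: pair_span_def)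
  then show ?thesis
    using that carrier by blast
next
  case False
  then obtain a b c where abc: "u = Some a" "v = Some b" "w = Some c" "distinct [a, b, c]"
    by (cases u; cases v; cases w) auto
  then have points: "a \<in> P" "b \<in> P" "c \<in> P"
    using carrier by auto
  then have "{a, b, c} \<in> B"
    using steiner_mult_not_assoc[of a b c] assoc abc by auto
  then have "{u, v, w} \<subseteq> pair_span u v"
    using abc by (simp add: pair_span_def third_point_eq)
  then show ?thesis
    using that carrier by blast
qed

end

section \<open>Oriented Hall loops\<close>

context oriented_hall_triple_system
begin

abbreviation f :: "'a option \<Rightarrow> 'a option \<Rightarrow> int" where "f \<equiv> factor_system4 B T"

lemma oriented_hall_loop4_eq: "oriented_hall_loop4 P B T = sign_extension S f"
  by (simp add: oriented_hall_loop4_def sign_extension_def steiner_loop_def)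

lemma normalized_factor_system4: "normalized_sign_factor S f"
proof -
  have "f u v \<in> {1, -1}" "f None u = 1 \<and> f u None = 1" for u v
    by (cases u; cases v; simp add: orientation_function_def)+
  then show ?thesis by (simp add: normalized_sign_factor_def)
qed

lemma oriented_triple_products:
  assumes "(x, y, z) \<in> T"
  shows "steiner_mult B (Some x) (Some y) = Some z" "steiner_mult B (Some y) (Some x) = Some z"
    "f (Some x) (Some y) = 1" "f (Some y) (Some x) = -1"
proof -
  have block: "{x, y, z} \<in> B"
    using assms by (rule orient_block)
  then have third: "x \<noteq> y" "third_point B x y = z" "third_point B y x = z"
    by (simp_all add: block_distinct third_point_eq third_point_commute[of B y])
  have "(y, x, z) \<notin> T"
    using assms orient_choice[OF block] orient_rotate by blast
  then show "steiner_mult B (Some x) (Some y) = Some z" "steiner_mult B (Some y) (Some x) = Some z"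
    "f (Some x) (Some y) = 1" "f (Some y) (Some x) = -1"
    using assms third by (simp_all add: orientation_function_def)
qed

lemma pair_span_associative_cocycle_if_oriented:
  assumes "(x, y, z) \<in> T"
  shows "associative_on S (pair_span (Some x) (Some y)) \<and>
    cocycle_on S f (pair_span (Some x) (Some y))"
proof -
  have rotations: "(y, z, x) \<in> T" "(z, x, y) \<in> T"
    using assms orient_rotate by blast+
  note table = oriented_triple_products[OF assms]
    oriented_triple_products[OF rotations(1)] oriented_triple_products[OF rotations(2)]
  have span: "pair_span (Some x) (Some y) = {None, Some x, Some y, Some z}"
    using table by (simp add: pair_span_def)
  show ?thesis
    unfolding span associative_on_def cocycle_on_def using table by simp
qed

lemma pair_span_associative_cocycle:
  assumes "u \<in> carrier S" "v \<in> carrier S"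
  shows "associative_on S (pair_span u v) \<and> cocycle_on S f (pair_span u v)"
proof -
  consider t where "pair_span u v = {None, t}"
    | x y where "u = Some x" "v = Some y" "x \<noteq> y"
  proof (cases "u = None \<or> v = None \<or> u = v")
    case True
    then have "pair_span u v = {None, u} \<or> pair_span u v = {None, v}"
      by (auto simp: pair_span_def)
    then show thesis
      using that(1) by blast
  next
    case False
    then show thesis
      using that(2) by (cases u; cases v) auto
  qed
  then show ?thesis
  proof cases
    fix t assume "pair_span u v = {None, t}"
    then show ?thesis
      by (cases t) (auto simp: associative_on_def cocycle_on_def)
  next
    fix x y assume xy: "u = Some x" "v = Some y" "x \<noteq> y"
    let ?z = "third_point B x y"
    have "{x, y, ?z} \<in> B"
      using assms xy third_point_block by auto
    then have "(x, y, ?z) \<in> T \<or> (y, x, ?z) \<in> T"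
      using orient_choice orient_rotate by blast
    then show ?thesis
      using pair_span_associative_cocycle_if_oriented pair_span_commute xy by metis
  qed
qed

end

theorem theorem1:
  fixes P :: "'a set" and B :: "'a set set" and T :: "('a \<times> 'a \<times> 'a) set"
  assumes "oriented_hall_triple_system P B T"
  shows "satisfies_moufang_theorem (oriented_hall_loop4 P B T)"
proof -
  interpret oriented_hall_triple_system P B T by fact
  have "satisfies_moufang_theorem (sign_extension S f)"
  proof (rule satisfies_moufang_theorem_sign_extension)
    fix u v w
    assume "u \<in> carrier S" "v \<in> carrier S" "w \<in> carrier S"
      and "u \<otimes>\<^bsub>S\<^esub> (v \<otimes>\<^bsub>S\<^esub> w) = (u \<otimes>\<^bsub>S\<^esub> v) \<otimes>\<^bsub>S\<^esub> w"
    then obtain s t where st: "s \<in> carrier S" "t \<in> carrier S"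
      and span: "{u, v, w} \<subseteq> pair_span s t"
      unfolding steiner_loop_simps(2) by (rule associating_triple_in_pair_span)
    show "\<exists>H. subloop H S \<and> {u, v, w} \<subseteq> H \<and> associative_on S H \<and> cocycle_on S f H"
      using subloop_pair_span[OF st] span pair_span_associative_cocycle[OF st]
      by (intro exI[of _ "pair_span s t"] conjI) simp_all
  qed (rule is_loop_steiner_loop normalized_factor_system4)+
  then show ?thesis
    by (simp only: oriented_hall_loop4_eq)
qed

end
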